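(* Let $K\ge1$ be an integer and let $p$ be an odd prime with $p\mid K^2+4$. Then the multiplicative order of $2^{-1}K$ modulo $p$ equals $4$, and $\pi_K(p)=4p$.
   Context: The $K$-Fibonacci sequence is $F_{K,0}=0$, $F_{K,1}=1$, $F_{K,n}=K F_{K,n-1}+F_{K,n-2}$; for an integer $m>1$, $\pi_K(m)$ is the length of its shortest period modulo $m$. Here $2^{-1}$ denotes the inverse of $2$ modulo $p$. *)

theory Defs
  imports "HOL-Number_Theory.Number_Theory"
begin

fun K_fib :: "int \<Rightarrow> nat \<Rightarrow> int" where
  "K_fib K 0 = 0"
| "K_fib K (Suc 0) = 1"
| "K_fib K (Suc (Suc n)) = K * K_fib K (Suc n) + K_fib K n"

text \<open>
  The recurrence is invertible modulo every \<open>m\<close>, so the reduced sequence is periodic from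
  index \<open>0\<close> onwards and a period may be required to hold at all indices; this also ensures that
  the set whose least element is taken is nonempty for \<open>m > 1\<close>.
\<close>
definition K_fib_period :: "int \<Rightarrow> int \<Rightarrow> nat" where
  "K_fib_period K m = (LEAST t. t > 0 \<and> (\<forall>n. [K_fib K (n + t) = K_fib K n] (mod m)))"

end

theory Submission
  imports Defs
begin

text \<open>
  Put \<open>a = 2\<^sup>-\<^sup>1 K\<close>. The hypothesis says \<open>a\<^sup>2 = -1\<close> modulo \<open>p\<close>, so \<open>a\<close> has order \<open>4\<close>, and the
  characteristic polynomial \<open>x\<^sup>2 - K x - 1\<close> of the recurrence becomes \<open>(x - a)\<^sup>2\<close>. Because of this
  double root the \<open>n\<close>-th term is \<open>n a\<^sup>n\<^sup>-\<^sup>1\<close>. A number \<open>t\<close> is a period if and only if the terms at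
  \<open>t\<close> and \<open>t + 1\<close> are \<open>0\<close> and \<open>1\<close>. The first condition means \<open>p dvd t\<close>, and then the second
  becomes \<open>a\<^sup>t = 1\<close>, that is, \<open>4 dvd t\<close>. As \<open>p\<close> is odd, the two together say \<open>4 p dvd t\<close>.
\<close>

lemma Least_pos_dvd:
  fixes d :: nat
  assumes "d > 0"
  shows "(LEAST n. n > 0 \<and> d dvd n) = d"
  using assms by (intro Least_equality) (auto dest: dvd_imp_le)

lemma ord_eqI:
  fixes a m :: "'a :: {unique_euclidean_semiring, semiring_gcd}"
  assumes "d > 0" and power_cong: "\<And>n. [a ^ n = 1] (mod m) \<longleftrightarrow> d dvd n"
  shows "ord m a = d"
proof -
  have "coprime (a ^ d) m"
    using coprime_cong_cong_left[of "a ^ d" 1 m] power_cong[of d] by simp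
  then have "coprime m a"
    using \<open>d > 0\<close> by (simp add: coprime_commute)
  then show ?thesis
    using \<open>d > 0\<close> by (simp add: ord_def power_cong Least_pos_dvd)
qed

lemma minus_one_power_cong_1_iff:
  fixes m :: "'a :: unique_euclidean_ring"
  assumes "\<not> m dvd 2"
  shows "[(-1) ^ n = 1] (mod m) \<longleftrightarrow> even n"
  using assms by (cases "even n") (simp_all add: cong_iff_dvd_diff)

lemma sqrt_minus_one_power_cong_1_iff:
  fixes a m :: "'a :: unique_euclidean_ring"
  assumes "\<not> m dvd 2" and square: "[a\<^sup>2 = -1] (mod m)"
  shows "[a ^ n = 1] (mod m) \<longleftrightarrow> 4 dvd n"
proof -
  have even_power: "[a ^ (2 * k) = 1] (mod m) \<longleftrightarrow> even k" for k
  proof -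
    have "[a ^ (2 * k) = (-1) ^ k] (mod m)"
      using cong_pow[OF square] by (simp add: power_mult)
    then show ?thesis
      using minus_one_power_cong_1_iff[OF \<open>\<not> m dvd 2\<close>] by (meson cong_sym cong_trans)
  qed
  have "even n" if "[a ^ n = 1] (mod m)"
    using cong_pow[OF that, of 2] even_power[of n] by (simp add: power_even_eq)
  moreover have "[a ^ n = 1] (mod m) \<longleftrightarrow> 4 dvd n" if "even n"
    using that even_power by (auto elim!: evenE)
  moreover have "even n" if "4 dvd n"
    using that by (rule dvd_trans[rotated]) simp
  ultimately show ?thesis
    by blast
qed

lemma ord_sqrt_minus_one:
  fixes a m :: "'a :: {unique_euclidean_ring, semiring_gcd}"
  assumes "\<not> m dvd 2" and "[a\<^sup>2 = -1] (mod m)"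
  shows "ord m a = 4"
  using sqrt_minus_one_power_cong_1_iff[OF assms] by (intro ord_eqI) simp_all

lemma K_fib_shift_cong_iff:
  "(\<forall>n. [K_fib K (n + t) = K_fib K n] (mod m)) \<longleftrightarrow>
    [K_fib K t = 0] (mod m) \<and> [K_fib K (Suc t) = 1] (mod m)"
    (is "?periodic \<longleftrightarrow> ?initial")
proof
  assume ?periodic
  from spec[OF this, of 0] spec[OF this, of 1] show ?initial
    by simp
next
  assume initial: ?initial
  have "[K_fib K (n + t) = K_fib K n] (mod m)" for n
    by (induction n rule: induct_nat_012) (use initial in \<open>simp_all add: cong_add cong_scalar_left\<close>)
  then show ?periodic ..
qed

lemma K_fib_period_eqI:
  assumes "d > 0"
    and "\<And>t. [K_fib K t = 0] (mod m) \<and> [K_fib K (Suc t) = 1] (mod m) \<longleftrightarrow> d dvd t"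
  shows "K_fib_period K m = d"
  using assms by (simp add: K_fib_period_def K_fib_shift_cong_iff Least_pos_dvd)

lemma K_fib_Suc_cong_double_root:
  fixes a K m :: int
  assumes K: "[K = 2 * a] (mod m)" and square: "[a\<^sup>2 = -1] (mod m)"
  shows "[K_fib K (Suc n) = int (Suc n) * a ^ n] (mod m)"
proof (induction n rule: induct_nat_012)
  case 0
  show ?case by simp
next
  case 1
  show ?case using K by simp
next
  case (ge2 n)
  have "[K_fib K (Suc (Suc (Suc n))) =
      2 * a * (int (Suc (Suc n)) * a ^ Suc n) + int (Suc n) * a ^ n] (mod m)"
    unfolding K_fib.simps(3)[of K "Suc n"] by (intro cong_add cong_mult K ge2)
  also have "2 * a * (int (Suc (Suc n)) * a ^ Suc n) + int (Suc n) * a ^ n =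
      int (Suc (Suc (Suc n))) * a ^ Suc (Suc n) + (a\<^sup>2 - (-1)) * (int (Suc n) * a ^ n)"
    by (simp add: algebra_simps power2_eq_square)
  also have "[\<dots> = int (Suc (Suc (Suc n))) * a ^ Suc (Suc n) + 0] (mod m)"
    using square by (intro cong_add cong_refl) (simp add: cong_iff_dvd_diff)
  finally show ?case by simp
qed

lemma K_fib_cong_0_iff_double_root:
  fixes a K m :: int
  assumes "[K = 2 * a] (mod m)" and square: "[a\<^sup>2 = -1] (mod m)"
  shows "[K_fib K n = 0] (mod m) \<longleftrightarrow> m dvd int n"
proof (cases n)
  case (Suc k)
  have "coprime (a\<^sup>2) m"
    using coprime_cong_cong_left[OF square] by simp
  then have "coprime m (a ^ k)"
    by (simp add: coprime_commute)
  then show ?thesis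
    using cong_dvd_iff[OF K_fib_Suc_cong_double_root[OF assms, of k]]
    by (simp only: Suc cong_0_iff coprime_dvd_mult_left_iff)
qed simp

lemma K_fib_period_double_root:
  fixes a K m :: int
  assumes "odd m" and "m > 2" and K: "[K = 2 * a] (mod m)" and square: "[a\<^sup>2 = -1] (mod m)"
  shows "int (K_fib_period K m) = 4 * m"
proof -
  have "\<not> m dvd 2"
    using \<open>m > 2\<close> by (simp add: zdvd_not_zless)
  have Suc_term: "[K_fib K (Suc t) = 1] (mod m) \<longleftrightarrow> 4 dvd t" if "m dvd int t" for t
  proof -
    have "[int (Suc t) * a ^ t = a ^ t] (mod m)"
      using that by (simp add: cong_iff_dvd_diff algebra_simps)
    with K_fib_Suc_cong_double_root[OF K square] have "[K_fib K (Suc t) = a ^ t] (mod m)"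
      by (rule cong_trans)
    then show ?thesis
      using sqrt_minus_one_power_cong_1_iff[OF \<open>\<not> m dvd 2\<close> square] by (meson cong_sym cong_trans)
  qed
  have "coprime (2 ^ 2) m"
    using \<open>odd m\<close> by (subst coprime_power_left_iff) simp
  then have "coprime 4 m"
    by simp
  have "K_fib_period K m = nat (4 * m)"
  proof (rule K_fib_period_eqI)
    fix t
    have "[K_fib K t = 0] (mod m) \<and> [K_fib K (Suc t) = 1] (mod m) \<longleftrightarrow> m dvd int t \<and> 4 dvd t"
      using K_fib_cong_0_iff_double_root[OF K square] Suc_term by blast
    also have "\<dots> \<longleftrightarrow> m dvd int t \<and> 4 dvd int t"
      by presburger
    also have "\<dots> \<longleftrightarrow> 4 * m dvd int t"
      using \<open>coprime 4 m\<close> by (auto intro: divides_mult dest: dvd_mult_left dvd_mult_right)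
    also have "\<dots> \<longleftrightarrow> nat (4 * m) dvd t"
      using \<open>m > 2\<close> by (simp add: nat_dvd_iff)
    finally show "[K_fib K t = 0] (mod m) \<and> [K_fib K (Suc t) = 1] (mod m) \<longleftrightarrow>
        nat (4 * m) dvd t" .
  qed (use \<open>m > 2\<close> in simp)
  then show ?thesis
    using \<open>m > 2\<close> by simp
qed

lemma half_square_cong_minus_one:
  fixes a K m :: int
  assumes "odd m" and K: "[K = 2 * a] (mod m)" and "m dvd K\<^sup>2 + 4"
  shows "[a\<^sup>2 = -1] (mod m)"
proof -
  have "[2\<^sup>2 * a\<^sup>2 = K\<^sup>2] (mod m)"
    using cong_sym[OF cong_pow[OF K, of 2]] by (simp add: power_mult_distrib)
  also have "[K\<^sup>2 = 2\<^sup>2 * (-1)] (mod m)"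
    using \<open>m dvd K\<^sup>2 + 4\<close> by (simp add: cong_iff_dvd_diff)
  finally have "[2\<^sup>2 * a\<^sup>2 = 2\<^sup>2 * (-1)] (mod m)" .
  moreover have "coprime (2\<^sup>2) m"
    using \<open>odd m\<close> by (subst coprime_power_left_iff) simp
  ultimately show ?thesis
    by (simp only: cong_mult_lcancel)
qed

theorem theorem2p7:
  fixes K p :: int
  assumes "K \<ge> 1" and "prime p" and "odd p" and "p dvd K\<^sup>2 + 4"
  shows "ord p (modular_inverse p 2 * K) = 4 \<and> int (K_fib_period K p) = 4 * p"
proof -
  define a where "a = modular_inverse p 2 * K"
  have "p > 2"
    using prime_ge_2_int[OF \<open>prime p\<close>] \<open>odd p\<close> by (cases "p = 2") auto
  then have "\<not> p dvd 2"
    by (simp add: zdvd_not_zless)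
  have "[2 * modular_inverse p 2 = 1] (mod p)"
    using \<open>odd p\<close> by (intro cong_modular_inverse1) simp
  from cong_sym[OF cong_scalar_right[OF this, of K]] have K: "[K = 2 * a] (mod p)"
    by (simp add: a_def mult.assoc)
  have square: "[a\<^sup>2 = -1] (mod p)"
    using \<open>odd p\<close> K \<open>p dvd K\<^sup>2 + 4\<close> by (rule half_square_cong_minus_one)
  have "ord p a = 4"
    using \<open>\<not> p dvd 2\<close> square by (rule ord_sqrt_minus_one)
  moreover have "int (K_fib_period K p) = 4 * p"
    using \<open>odd p\<close> \<open>p > 2\<close> K square by (rule K_fib_period_double_root)
  ultimately show ?thesis
    by (simp add: a_def)
qed

end
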